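(* Let $\alpha,\beta,c,d>0$ and $l\ge 0$ be real constants, and let $(u_0,u_1)\in\mathbb{R}^2$. Then the equation $$\big(|u'|^{l}u'\big)'+c|u'|^{\alpha}u'+d|u|^{\beta}u=0$$ has a global solution $u$ on $\mathbb{R}^+$ satisfying $$u\in \mathcal{C}^1(\mathbb{R}^+),\qquad |u'|^{l}u'\in \mathcal{C}^1(\mathbb{R}^+),\qquad u(0)=u_0,\quad u'(0)=u_1.$$
   Context: $\mathbb{R}^+=[0,+\infty)$. A solution on an interval $J$ is a function $u\in\mathcal{C}^1(J)$ with $|u'|^lu'\in\mathcal{C}^1(J)$ which satisfies the equation at every point of $J$. *)

theory Defs
  imports "HOL-Analysis.Analysis"
begin

text \<open>
  The derivative along \<open>J\<close>, one-sided at an endpoint of \<open>J\<close> that belongs to \<open>J\<close>.  It is meant for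
  intervals with more than one point, where derivatives within \<open>J\<close> are unique.
\<close>

abbreviation deriv_within :: "real set \<Rightarrow> (real \<Rightarrow> real) \<Rightarrow> real \<Rightarrow> real" where
  "deriv_within J f t \<equiv> vector_derivative f (at t within J)"

text \<open>
  The library's \<open>C1_differentiable_on\<close> is not used because it asks for two-sided derivatives, hence
  constrains \<open>f\<close> outside \<open>J\<close> when \<open>J\<close> is not open.
\<close>

definition C1_on :: "real set \<Rightarrow> (real \<Rightarrow> real) \<Rightarrow> bool" where
  "C1_on J f \<longleftrightarrow> f differentiable_on J \<and> continuous_on J (deriv_within J f)"

text \<open>
  The map $x \mapsto |x|^p x$.  Since \<open>0 powr p = 0\<close> for every \<open>p\<close>, it vanishes at \<open>0\<close>, and for
  \<open>p = 0\<close> it is the identity.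
\<close>

definition signed_power :: "real \<Rightarrow> real \<Rightarrow> real" where
  "signed_power p x = \<bar>x\<bar> powr p * x"

definition is_solution ::
    "real \<Rightarrow> real \<Rightarrow> real \<Rightarrow> real \<Rightarrow> real \<Rightarrow> real set \<Rightarrow> (real \<Rightarrow> real) \<Rightarrow> bool" where
  "is_solution l \<alpha> \<beta> c d J u \<longleftrightarrow>
     C1_on J u \<and>
     C1_on J (\<lambda>t. signed_power l (deriv_within J u t)) \<and>
     (\<forall>t\<in>J. deriv_within J (\<lambda>s. signed_power l (deriv_within J u s)) t
            + c * signed_power \<alpha> (deriv_within J u t) + d * signed_power \<beta> (u t) = 0)"

end

theory Submission
  imports Defs "HOL-Complex_Analysis.Great_Picard"
begin

text \<open>
  With $v = |u'|^l u'$ the equation becomes the system $u' = \varphi(v)$,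
  $v' = - c |\varphi(v)|^\alpha \varphi(v) - d |u|^\beta u$, where $\varphi$ inverts
  $x \mapsto |x|^l x$.  For $l > 0$ the function $\varphi$ is not Lipschitz at \<open>0\<close>, so existence has
  to come from compactness.  Delayed equations $z'(t) = F(z(t - h))$ are solved by iteration and,
  for bounded \<open>F\<close>, their solutions are equi-Lipschitz; a pointwise limit as $h \to 0$ is a global
  solution by dominated convergence.  Boundedness is obtained by multiplying \<open>F\<close> by a cutoff of the
  energy $E = A(u) + B(v)$, $A' = d |u|^\beta u$, $B' = \varphi$.  Along solutions of the cut-off system
  $E$ does not increase, so they never meet the region where the cutoff differs from \<open>1\<close>.
\<close>

section \<open>Delay equations and the method of steps\<close>

text \<open>For \<open>t < a\<close> the interval is empty and the integral is \<open>0\<close>, so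
  the function is constant there and the estimate extends to the whole line. This lets delayed
  arguments be negative.\<close>

lemma lipschitz_on_indefinite_integral:
  fixes f :: "real \<Rightarrow> 'a::banach"
  assumes cont: "continuous_on UNIV f" and bd: "\<And>x. norm (f x) \<le> M"
  shows "M-lipschitz_on UNIV (\<lambda>t. integral {a..t} f)"
proof -
  have M: "0 \<le> M"
    using bd[of a] norm_ge_zero order_trans by blast
  have ordered: "norm (integral {a..t} f - integral {a..s} f) \<le> M * (t - s)" if "s \<le> t" for s t
  proof (cases "a \<le> s")
    case True
    have int: "f integrable_on {a..t}"
      by (intro integrable_continuous_interval continuous_on_subset[OF cont]) auto
    have "integral {a..t} f - integral {a..s} f = integral {s..t} f"
      using Henstock_Kurzweil_Integration.integral_combine[OF True that int]
      by (simp add: algebra_simps)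
    then show ?thesis
      using integral_bound[OF that, of f M] continuous_on_subset[OF cont] bd by simp
  next
    case False
    then have s: "integral {a..s} f = 0" by simp
    show ?thesis
    proof (cases "a \<le> t")
      case True
      have "norm (integral {a..t} f) \<le> M * (t - a)"
        using integral_bound[OF True, of f M] continuous_on_subset[OF cont] bd by simp
      also have "\<dots> \<le> M * (t - s)"
        using False M by (intro mult_left_mono) auto
      finally show ?thesis using s by simp
    next
      case False
      then show ?thesis using s M that by simp
    qed
  qed
  show ?thesis
  proof (rule lipschitz_onI[OF _ M])
    fix s t :: real
    show "dist (integral {a..s} f) (integral {a..t} f) \<le> M * dist s t"
      using ordered[of s t] ordered[of t s]
      by (cases "s \<le> t") (auto simp: dist_norm norm_minus_commute)
  qed
qed

lemma continuous_on_compose_delay: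
  fixes h :: "'c::real_normed_vector"
  assumes "continuous_on UNIV F" "continuous_on UNIV z"
  shows "continuous_on S (\<lambda>s. F (z (s - h)))"
proof -
  have "continuous_on S (\<lambda>s. s - h)"
    by (intro continuous_intros)
  from continuous_on_compose2[OF assms(2) this] have "continuous_on S (\<lambda>s. z (s - h))"
    by simp
  from continuous_on_compose2[OF assms(1) this] show ?thesis
    by simp
qed

text \<open>The right-hand side at time \<open>s\<close> sees \<open>z\<close> only up to
  \<open>s - h\<close>, so Picard iteration becomes stationary on \<open>{0..T}\<close> after
  finitely many steps. The Lipschitz constant \<open>M\<close> does not depend on \<open>h\<close>,
  which makes the compactness argument possible.\<close>

lemma delayed_ode_solution:
  fixes F :: "'a::banach \<Rightarrow> 'a" and h T :: real
  assumes cont: "continuous_on UNIV F" and bd: "\<And>x. norm (F x) \<le> M" and h: "h > 0"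
  obtains z where "M-lipschitz_on UNIV z"
    "\<And>t. t \<in> {0..T} \<Longrightarrow> z t = x0 + integral {0..t} (\<lambda>s. F (z (s - h)))"
proof -
  define y where "y = rec_nat (\<lambda>_. x0) (\<lambda>_ g t. x0 + integral {0..t} (\<lambda>s. F (g (s - h))))"
  have y0: "y 0 t = x0" and ySuc: "y (Suc k) t = x0 + integral {0..t} (\<lambda>s. F (y k (s - h)))" for k t
    by (simp_all add: y_def)
  have M: "0 \<le> M"
    using bd[of x0] norm_ge_zero order_trans by blast
  have lip: "M-lipschitz_on UNIV (y k)" for k
  proof (induction k)
    case 0
    show ?case using M by (auto simp: y0 lipschitz_on_def)
  next
    case (Suc k)
    have "continuous_on UNIV (\<lambda>s. F (y k (s - h)))"
      by (rule continuous_on_compose_delay[OF cont lipschitz_on_continuous_on[OF Suc]])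
    then have "M-lipschitz_on UNIV (\<lambda>t. integral {0..t} (\<lambda>s. F (y k (s - h))))"
      by (rule lipschitz_on_indefinite_integral) (rule bd)
    then show ?case by (simp add: lipschitz_on_def ySuc)
  qed
  \<comment> \<open>Each iteration gains one delay: for \<open>s \<le> (k + 1) * h\<close> the
    argument \<open>s - h\<close> lies where the previous iterates already agree. At the start,
    \<open>t \<le> 0\<close> makes the integral vanish.\<close>
  have stable: "y (Suc k) t = y k t" if "t \<le> real k * h" for k t
    using that
  proof (induction k arbitrary: t)
    case 0
    then have "t = 0 \<or> t < 0" by auto
    then show ?case by (auto simp: y0 ySuc)
  next
    case (Suc k)
    have "F (y (Suc k) (s - h)) = F (y k (s - h))" if "s \<in> {0..t}" for s
      using that Suc.prems Suc.IH[of "s - h"] by (simp add: algebra_simps)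
    then have "integral {0..t} (\<lambda>s. F (y (Suc k) (s - h))) = integral {0..t} (\<lambda>s. F (y k (s - h)))"
      by (rule integral_cong)
    then show ?case unfolding ySuc[of "Suc k"] ySuc[of k] by simp
  qed
  obtain k :: nat where k: "T < real k * h"
    using reals_Archimedean3[OF h] by blast
  show thesis
  proof (rule that[of "y (Suc k)"])
    show "M-lipschitz_on UNIV (y (Suc k))" by (rule lip)
    show "y (Suc k) t = x0 + integral {0..t} (\<lambda>s. F (y (Suc k) (s - h)))" if t: "t \<in> {0..T}" for t
    proof -
      \<comment> \<open>\<open>y (Suc k)\<close> is defined through \<open>y k\<close>; replacing
        \<open>y k\<close> by \<open>y (Suc k)\<close> under the integral closes the fixed-point
        equation.\<close>
      have "integral {0..t} (\<lambda>s. F (y k (s - h))) = integral {0..t} (\<lambda>s. F (y (Suc k) (s - h)))"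
      proof (rule integral_cong)
        fix s assume "s \<in> {0..t}"
        then have "s - h \<le> real k * h" using t k h by simp
        then show "F (y k (s - h)) = F (y (Suc k) (s - h))" by (simp only: stable)
      qed
      then show ?thesis by (simp only: ySuc[of k t])
    qed
  qed
qed

section \<open>Compactness and the Peano theorem for bounded fields\<close>

text \<open>A diagonal subsequence converges on a countable dense set, and the common Lipschitz
  constant carries the Cauchy property to every other point. Pointwise limits are all that dominated
  convergence asks for.\<close>

lemma equilipschitz_pointwise_convergent_subsequence:
  fixes z :: "nat \<Rightarrow> 'a::{second_countable_topology,metric_space} \<Rightarrow> 'b::{banach,heine_borel}"
  assumes lip: "\<And>n. M-lipschitz_on UNIV (z n)" and bd: "\<And>n. norm (z n a) \<le> B"
  obtains r x where "strict_mono (r :: nat \<Rightarrow> nat)" "\<And>t. (\<lambda>n. z (r n) t) \<longlonglongrightarrow> x t"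
proof -
  obtain D :: "'a set" where D: "countable D" "\<And>U. open U \<Longrightarrow> U \<noteq> {} \<Longrightarrow> \<exists>d\<in>D. d \<in> U"
    using countable_dense_setE by blast
  have M: "0 \<le> M"
    using lip lipschitz_on_nonneg by blast
  have B: "0 \<le> B"
    using bd[of 0] norm_ge_zero order_trans by blast
  \<comment> \<open>The functions \<open>z n\<close> may grow linearly in the distance to
    \<open>a\<close>, whereas \<open>function_convergent_subsequence\<close> takes one bound for all
    points. Dividing by the weight \<open>w\<close> gives the bound \<open>1\<close>; the summand
    \<open>1\<close> keeps \<open>w\<close> positive.\<close>
  define w where "w t = B + M * dist t a + 1" for t
  have w: "w t > 0" for t
    using M B by (simp add: w_def add_nonneg_pos)
  have "norm (z n t) \<le> w t" for n t
  proof -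
    have "norm (z n t) \<le> norm (z n a) + dist (z n t) (z n a)"
      by (metis add.commute dist_norm norm_triangle_sub)
    also have "\<dots> \<le> w t"
      using bd[of n] lipschitz_onD[OF lip[of n], of t a] by (simp add: w_def)
    finally show ?thesis .
  qed
  then have "norm (z n t /\<^sub>R w t) \<le> 1" for n t
    using w[of t] by (simp add: divide_simps)
  then obtain r where r: "strict_mono (r :: nat \<Rightarrow> nat)"
    and conv: "\<And>t. t \<in> D \<Longrightarrow> \<exists>l. (\<lambda>n. z (r n) t /\<^sub>R w t) \<longlonglongrightarrow> l"
    using function_convergent_subsequence[OF D(1), of "\<lambda>n t. z n t /\<^sub>R w t" 1] by metis
  have convD: "Cauchy (\<lambda>n. z (r n) t)" if "t \<in> D" for t
  proof -
    from conv[OF that] obtain l where "(\<lambda>n. z (r n) t /\<^sub>R w t) \<longlonglongrightarrow> l" by blast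
    then have "(\<lambda>n. w t *\<^sub>R (z (r n) t /\<^sub>R w t)) \<longlonglongrightarrow> w t *\<^sub>R l"
      by (intro tendsto_intros)
    then have "(\<lambda>n. z (r n) t) \<longlonglongrightarrow> w t *\<^sub>R l"
      using w[of t] by simp
    then show ?thesis by (rule LIMSEQ_imp_Cauchy)
  qed
  have "Cauchy (\<lambda>n. z (r n) t)" for t
  proof (rule metric_CauchyI)
    fix e :: real assume e: "e > 0"
    \<comment> \<open>Moving by less than \<delta> changes every \<open>z n\<close> by at most
      \<open>e / 3\<close>; \<open>M + 1\<close> keeps the denominator positive when
      \<open>M = 0\<close>.\<close>
    define \<delta> where "\<delta> = e / (3 * (M + 1))"
    have \<delta>: "\<delta> > 0" using e M by (simp add: \<delta>_def)
    obtain q where q: "q \<in> D" "dist t q < \<delta>"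
      using D(2)[of "ball t \<delta>"] \<delta> by auto
    have near: "dist (z n t) (z n q) \<le> e / 3" for n
    proof -
      have "dist (z n t) (z n q) \<le> M * dist t q"
        using lipschitz_onD[OF lip] by simp
      also have "\<dots> \<le> (M + 1) * \<delta>"
        using q M by (intro mult_mono) auto
      also have "\<dots> = e / 3"
        using M by (simp add: \<delta>_def divide_simps)
      finally show ?thesis .
    qed
    obtain N where N: "\<And>m n. m \<ge> N \<Longrightarrow> n \<ge> N \<Longrightarrow> dist (z (r m) q) (z (r n) q) < e / 3"
      using metric_CauchyD[OF convD[OF q(1)], of "e / 3"] e by auto
    have "dist (z (r m) t) (z (r n) t) < e" if "m \<ge> N" "n \<ge> N" for m n
    proof -
      have "dist (z (r m) t) (z (r n) t)
          \<le> dist (z (r m) t) (z (r m) q) + dist (z (r m) q) (z (r n) q) + dist (z (r n) t) (z (r n) q)"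
        using dist_triangle[of "z (r m) t" "z (r n) t" "z (r m) q"]
          dist_triangle2[of "z (r m) q" "z (r n) t" "z (r n) q"] by (simp add: dist_commute)
      also have "\<dots> < e"
        using near[of "r m"] near[of "r n"] N[OF that] by simp
      finally show ?thesis .
    qed
    then show "\<exists>N. \<forall>m\<ge>N. \<forall>n\<ge>N. dist (z (r m) t) (z (r n) t) < e" by blast
  qed
  then have "(\<lambda>n. z (r n) t) \<longlonglongrightarrow> lim (\<lambda>n. z (r n) t)" for t
    by (simp add: Cauchy_convergent_iff convergent_LIMSEQ_iff)
  with r show thesis by (rule that)
qed

text \<open>The bound \<open>M\<close> serves twice: as the common Lipschitz constant of the delayed
  solutions and as the dominating function when passing to the limit in their integral
  equations.\<close>

theorem Peano_global_bounded:
  fixes F :: "'a::euclidean_space \<Rightarrow> 'a"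
  assumes cont: "continuous_on UNIV F" and bd: "\<And>x. norm (F x) \<le> M"
  obtains x where "x 0 = x0"
    "\<And>t. t \<ge> 0 \<Longrightarrow> (x has_vector_derivative F (x t)) (at t within {0..})"
proof -
  \<comment> \<open>The horizon \<open>n\<close> grows while the delay \<open>1 / Suc n\<close>
    shrinks, so a single sequence covers all of \<open>{0..}\<close>.\<close>
  have "\<exists>z. M-lipschitz_on UNIV z \<and>
      (\<forall>t\<in>{0..real n}. z t = x0 + integral {0..t} (\<lambda>s. F (z (s - 1 / Suc n))))" for n :: nat
    using delayed_ode_solution[OF cont bd, of "1 / Suc n" "real n" x0] by (metis of_nat_0_less_iff zero_less_Suc zero_less_divide_1_iff)
  then obtain z where lip: "\<And>n. M-lipschitz_on UNIV (z n)"
    and z: "\<And>n t. t \<in> {0..real n} \<Longrightarrow> z n t = x0 + integral {0..t} (\<lambda>s. F (z n (s - 1 / Suc n)))"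
    by metis
  have z0: "z n 0 = x0" for n
    using z[of 0 n] by simp
  obtain r x where r: "strict_mono (r :: nat \<Rightarrow> nat)" and x: "\<And>t. (\<lambda>n. z (r n) t) \<longlonglongrightarrow> x t"
    using equilipschitz_pointwise_convergent_subsequence[where z = z and a = 0 and B = "norm x0"] lip z0
    by (metis order_refl)
  have x0: "x 0 = x0"
    using x[of 0] by (simp add: z0 LIMSEQ_const_iff)
  have lipx: "M-lipschitz_on UNIV x"
  proof (rule lipschitz_onI)
    show "dist (x s) (x t) \<le> M * dist s t" for s t
      using lipschitz_onD[OF lip] by (intro LIMSEQ_le_const2[OF tendsto_dist[OF x x]]) auto
  qed (use lip lipschitz_on_nonneg in blast)
  \<comment> \<open>The common Lipschitz constant makes the effect of the delay at most
    \<open>M / Suc (r n)\<close>.\<close>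
  have delay: "(\<lambda>n. z (r n) (s - 1 / Suc (r n))) \<longlonglongrightarrow> x s" for s
  proof -
    have "(\<lambda>n. M * (1 / Suc (r n))) \<longlonglongrightarrow> M * 0"
      using LIMSEQ_subseq_LIMSEQ[OF lim_1_over_n[THEN LIMSEQ_Suc] r]
      by (intro tendsto_intros) (simp add: o_def)
    moreover have "dist (z (r n) (s - 1 / Suc (r n))) (z (r n) s) \<le> M * (1 / Suc (r n))" for n
      using lipschitz_onD[OF lip[of "r n"], of "s - 1 / Suc (r n)" s] by (simp add: dist_real_def)
    ultimately have "(\<lambda>n. z (r n) (s - 1 / Suc (r n)) - z (r n) s) \<longlonglongrightarrow> 0"
      using Lim_null_comparison[of "\<lambda>n. z (r n) (s - 1 / Suc (r n)) - z (r n) s"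
          "\<lambda>n. M * (1 / Suc (r n))" sequentially]
      by (simp add: dist_norm)
    from tendsto_add[OF this x[of s]] show ?thesis by simp
  qed
  have eq: "x t = x0 + integral {0..t} (\<lambda>s. F (x s))" if "t \<ge> 0" for t
  proof -
    have "(\<lambda>n. integral {0..t} (\<lambda>s. F (z (r n) (s - 1 / Suc (r n))))) \<longlonglongrightarrow> integral {0..t} (\<lambda>s. F (x s))"
    proof (rule dominated_convergence(2)[where h = "\<lambda>_. M"])
      show "(\<lambda>s. F (z (r n) (s - 1 / Suc (r n)))) integrable_on {0..t}" for n
        by (intro integrable_continuous_interval
            continuous_on_compose_delay[OF cont lipschitz_on_continuous_on[OF lip]])
      show "(\<lambda>n. F (z (r n) (s - 1 / Suc (r n)))) \<longlonglongrightarrow> F (x s)" for s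
        using cont by (intro isCont_tendsto_compose[OF _ delay]) (simp add: continuous_on_eq_continuous_at)
    qed (use bd in auto)
    then have "(\<lambda>n. x0 + integral {0..t} (\<lambda>s. F (z (r n) (s - 1 / Suc (r n))))) \<longlonglongrightarrow>
        x0 + integral {0..t} (\<lambda>s. F (x s))"
      by (intro tendsto_intros)
    \<comment> \<open>Since \<open>r n \<ge> n\<close>, a fixed \<open>t\<close> eventually lies
      within the horizon of \<open>z (r n)\<close>.\<close>
    moreover have "\<forall>\<^sub>F n in sequentially. x0 + integral {0..t} (\<lambda>s. F (z (r n) (s - 1 / Suc (r n)))) = z (r n) t"
    proof -
      obtain N :: nat where N: "t \<le> N" using real_arch_simple by blast
      have "x0 + integral {0..t} (\<lambda>s. F (z (r n) (s - 1 / Suc (r n)))) = z (r n) t" if "n \<ge> N" for n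
        using z[of t "r n"] seq_suble[OF r, of n] that N \<open>t \<ge> 0\<close> by simp
      then show ?thesis unfolding eventually_sequentially by blast
    qed
    ultimately have "(\<lambda>n. z (r n) t) \<longlonglongrightarrow> x0 + integral {0..t} (\<lambda>s. F (x s))"
      by (rule Lim_transform_eventually)
    with x[of t] show ?thesis by (rule LIMSEQ_unique)
  qed
  have "(x has_vector_derivative F (x t)) (at t within {0..})" if t: "t \<ge> 0" for t
  proof -
    \<comment> \<open>Ending the interval at \<open>t + 1\<close> keeps \<open>t\<close> off its
      right end, so that derivatives at \<open>t\<close> within it and within \<open>{0..}\<close>
      coincide.\<close>
    have "continuous_on {0..t+1} (\<lambda>s. F (x s))"
      by (intro continuous_on_compose2[OF cont] continuous_on_subset[OF lipschitz_on_continuous_on[OF lipx]]) auto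
    then have "((\<lambda>u. integral {0..u} (\<lambda>s. F (x s))) has_vector_derivative F (x t)) (at t within {0..t+1})"
      using t by (intro integral_has_vector_derivative) auto
    then have "((\<lambda>u. x0 + integral {0..u} (\<lambda>s. F (x s))) has_vector_derivative F (x t)) (at t within {0..t+1})"
      by (auto intro!: derivative_eq_intros)
    then have "(x has_vector_derivative F (x t)) (at t within {0..t+1})"
      using t eq by (intro has_vector_derivative_transform[of t _ x]) auto
    moreover have "at t within {0..t+1} = at t within {0..}"
      using t by (intro at_within_nhd[of _ "{t-1<..<t+1}"]) auto
    ultimately show ?thesis by simp
  qed
  with x0 that show thesis by blast
qed

section \<open>Global existence from a Lyapunov function\<close>

text \<open>Multiplying the field by a nonnegative scalar preserves the sign of the derivative of
  \<open>E\<close> along it. Solutions of the cut-off equation thus stay where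
  \<open>E \<le> E x0\<close>, and there the two fields agree.\<close>

theorem ode_global_existence_Lyapunov:
  fixes F :: "'a::euclidean_space \<Rightarrow> 'a" and E :: "'a \<Rightarrow> real"
  assumes cont: "continuous_on UNIV F"
    and E: "\<And>x. (E has_derivative E' x) (at x)"
    and decr: "\<And>x. E' x (F x) \<le> 0"
    and coercive: "\<And>e. bounded {x. E x \<le> e}"
  obtains x where "x 0 = x0"
    "\<And>t. t \<ge> 0 \<Longrightarrow> (x has_vector_derivative F (x t)) (at t within {0..})"
proof -
  \<comment> \<open>\<theta> is \<open>1\<close> where \<open>E x \<le> E x0\<close>, vanishes where
    \<open>E x \<ge> E x0 + 1\<close>, and is affine in \<open>E x\<close> in between.\<close>
  define \<theta> where "\<theta> x = max 0 (min 1 (E x0 + 1 - E x))" for x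
  define G where "G x = \<theta> x *\<^sub>R F x" for x
  have \<theta>: "0 \<le> \<theta> x" "\<theta> x \<le> 1" for x
    by (auto simp: \<theta>_def)
  have contE: "continuous_on UNIV E"
    using E has_derivative_continuous continuous_at_imp_continuous_on by blast
  have contG: "continuous_on UNIV G"
    unfolding G_def \<theta>_def by (intro continuous_intros cont contE)
  have "compact (closure {x. E x \<le> E x0 + 1})"
    using coercive by (simp add: compact_closure)
  then have "bounded (F ` closure {x. E x \<le> E x0 + 1})"
    by (intro compact_imp_bounded compact_continuous_image continuous_on_subset[OF cont]) auto
  then have "bounded (F ` {x. E x \<le> E x0 + 1})"
    by (rule bounded_subset) (intro image_mono closure_subset)
  then obtain M where M: "M > 0" "\<And>x. E x \<le> E x0 + 1 \<Longrightarrow> norm (F x) \<le> M"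
    by (auto simp: bounded_pos)
  have bdG: "norm (G x) \<le> M" for x
  proof (cases "E x \<le> E x0 + 1")
    case True
    have "\<theta> x * norm (F x) \<le> 1 * M"
      using \<theta> M(2)[OF True] by (intro mult_mono) auto
    then show ?thesis using \<theta>(1)[of x] by (simp add: G_def)
  next
    case False
    then show ?thesis using M(1) by (simp add: G_def \<theta>_def)
  qed
  obtain x where x0: "x 0 = x0"
    and x: "\<And>t. t \<ge> 0 \<Longrightarrow> (x has_vector_derivative G (x t)) (at t within {0..})"
    using Peano_global_bounded[OF contG bdG] by metis
  have "E (x t) \<le> E x0" if t: "t \<ge> 0" for t
  proof -
    have "((\<lambda>t. E (x t)) has_derivative (\<lambda>h. h * (\<theta> (x s) * E' (x s) (F (x s))))) (at s within {0..t})"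
      if "s \<in> {0..t}" for s
    proof -
      \<comment> \<open>Linearity pulls both the increment \<open>h\<close> and the factor \<theta>
        out of the derivative of \<open>E\<close>.\<close>
      interpret lin: bounded_linear "E' (x s)"
        using E has_derivative_bounded_linear by blast
      have "(x has_derivative (\<lambda>h. h *\<^sub>R G (x s))) (at s within {0..t})"
        using x[of s] that unfolding has_vector_derivative_def
        by (auto intro: has_derivative_subset)
      from has_derivative_compose[OF this E]
      show ?thesis by (simp add: G_def lin.scaleR mult.assoc)
    qed
    with mvt_very_simple[of 0 t "\<lambda>t. E (x t)" "\<lambda>s h. h * (\<theta> (x s) * E' (x s) (F (x s)))"] t
    obtain s where "E (x t) - E (x 0) = (t - 0) * (\<theta> (x s) * E' (x s) (F (x s)))"
      by auto
    also have "\<dots> \<le> 0"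
      using t \<theta>(1)[of "x s"] decr[of "x s"] by (simp add: mult_nonneg_nonpos)
    finally show ?thesis by (simp add: x0)
  qed
  then have "G (x t) = F (x t)" if "t \<ge> 0" for t
    using that by (simp add: G_def \<theta>_def)
  with x x0 that show thesis by metis
qed

section \<open>Antiderivatives and signed powers\<close>

text \<open>The sign condition makes the antiderivative vanishing at \<open>0\<close> minimal there,
  hence nonnegative. Beyond \<open>1\<close> and \<open>-1\<close> its slope has modulus at least
  \<open>k\<close>, which gives linear growth; in between the claimed lower bound is
  nonpositive.\<close>

lemma coercive_antiderivative:
  fixes f :: "real \<Rightarrow> real"
  assumes cont: "continuous_on UNIV f" and sign: "\<And>x. f x * x \<ge> 0"
    and k: "k > 0" "\<And>x. \<bar>x\<bar> \<ge> 1 \<Longrightarrow> \<bar>f x\<bar> \<ge> k"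
  obtains A where "\<And>x. (A has_real_derivative f x) (at x)" "\<And>x. A x \<ge> k * (\<bar>x\<bar> - 1)"
proof -
  obtain A0 where A0: "\<And>x. (A0 has_vector_derivative f x) (at x)"
    using einterval_antiderivative[of "-\<infinity>" "\<infinity>" f] cont
    by (auto simp: continuous_on_eq_continuous_at)
  define A where "A x = A0 x - A0 0" for x
  have A: "(A has_real_derivative f x) (at x)" for x
    using A0[of x] unfolding A_def
    by (auto intro!: derivative_eq_intros simp: has_real_derivative_iff_has_vector_derivative)
  have pos: "f x \<ge> 0" if "x > 0" for x
    using sign[of x] that by (simp add: zero_le_mult_iff)
  have neg: "f x \<le> 0" if "x < 0" for x
    using sign[of x] that by (simp add: zero_le_mult_iff)
  have nonneg: "A x \<ge> 0" for x
  proof (cases x "0::real" rule: linorder_cases)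
    case less
    then obtain z where "x < z" "z < 0" "A 0 - A x = (0 - x) * f z"
      using MVT2[of x 0 A f] A by auto
    then show ?thesis
      using mult_nonpos_nonpos[of x "f z"] neg[of z] less by (simp add: A_def)
  next
    case greater
    then obtain z where "0 < z" "z < x" "A x - A 0 = (x - 0) * f z"
      using MVT2[of 0 x A f] A by auto
    then show ?thesis using pos[of z] by (simp add: A_def)
  qed (simp add: A_def)
  have "A x \<ge> k * (\<bar>x\<bar> - 1)" for x
  proof -
    consider "x > 1" | "x < -1" | "\<bar>x\<bar> \<le> 1" by linarith
    then show ?thesis
    proof cases
      case 1
      then obtain z where z: "1 < z" "z < x" "A x - A 1 = (x - 1) * f z"
        using MVT2[of 1 x A f] A by auto
      have "(x - 1) * k \<le> (x - 1) * f z"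
        using 1 z pos[of z] k(2)[of z] by (intro mult_left_mono) auto
      then have "k * (x - 1) \<le> A x - A 1" using z(3) by (simp add: algebra_simps)
      then show ?thesis using nonneg[of 1] 1 by simp
    next
      case 2
      then obtain z where z: "x < z" "z < -1" "A (-1) - A x = (-1 - x) * f z"
        using MVT2[of x "-1" A f] A by auto
      have "(-1 - x) * k \<le> (-1 - x) * - f z"
        using 2 z neg[of z] k(2)[of z] by (intro mult_left_mono) auto
      then have "k * (- x - 1) \<le> A x - A (-1)" using z(3) by (simp add: algebra_simps)
      then show ?thesis using nonneg[of "-1"] 2 by simp
    next
      case 3
      then have "k * (\<bar>x\<bar> - 1) \<le> 0" using k(1) by (simp add: mult_nonneg_nonpos)
      then show ?thesis using nonneg[of x] by simp
    qed
  qed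
  with A that show thesis by blast
qed

text \<open>This form yields continuity at \<open>0\<close> for \<open>-1 < p < 0\<close>, where
  \<open>\<bar>x\<bar> powr p\<close> itself is discontinuous but the exponent \<open>p + 1\<close>
  is positive.\<close>

lemma signed_power_eq: "signed_power p x = max 0 x powr (p + 1) - max 0 (- x) powr (p + 1)"
proof (cases x "0::real" rule: linorder_cases)
  case less
  then show ?thesis using powr_mult_base[of "-x" p] by (simp add: signed_power_def add.commute mult.commute)
next
  case greater
  then show ?thesis using powr_mult_base[of x p] by (simp add: signed_power_def add.commute mult.commute)
qed (simp add: signed_power_def)

lemma continuous_on_signed_power:
  assumes "p > -1"
  shows "continuous_on S (signed_power p)"
proof -
  have "continuous_on S (\<lambda>x. max 0 x powr (p + 1) - max 0 (- x) powr (p + 1))"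
    using assms by (intro continuous_intros continuous_on_powr') auto
  then show ?thesis by (simp add: signed_power_eq[abs_def])
qed

lemma abs_signed_power: "\<bar>signed_power p x\<bar> = \<bar>x\<bar> powr (p + 1)"
  by (cases "x = 0") (auto simp: signed_power_def abs_mult powr_add)

lemma signed_power_mult_self_nonneg: "signed_power p x * x \<ge> 0"
  by (simp add: signed_power_def mult.assoc)

text \<open>\<open>signed_power p\<close> is the odd power of degree \<open>p + 1\<close>, and
  composition multiplies degrees.\<close>

lemma signed_power_signed_power:
  assumes "(p + 1) * (q + 1) = 1"
  shows "signed_power p (signed_power q x) = x"
proof (cases "x = 0")
  case False
  have "(q + 1) * p + q = 0" using assms by (simp add: algebra_simps)
  then have "(\<bar>x\<bar> powr (q + 1)) powr p * \<bar>x\<bar> powr q = 1"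
    using False by (simp add: powr_powr flip: powr_add)
  moreover have "signed_power p (signed_power q x) = ((\<bar>x\<bar> powr (q + 1)) powr p * \<bar>x\<bar> powr q) * x"
    by (simp add: signed_power_def[of p] abs_signed_power) (simp add: signed_power_def)
  ultimately show ?thesis by simp
qed (simp add: signed_power_def)

section \<open>The first-order system and its energy\<close>

text \<open>In the derivative of the energy the products \<open>f u * g v\<close> from the two
  equations cancel, leaving only the damping term, which has the right sign because a signed power
  has the sign of its argument.\<close>

theorem damped_system_global_existence:
  fixes \<alpha> \<beta> c d p u0 v0 :: real
  assumes "\<alpha> > -1" "\<beta> > -1" "c \<ge> 0" "d > 0" "p > -1"
  obtains u v where "u 0 = u0" "v 0 = v0"
    "\<And>t. t \<ge> 0 \<Longrightarrow> (u has_vector_derivative signed_power p (v t)) (at t within {0..})"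
    "\<And>t. t \<ge> 0 \<Longrightarrow> (v has_vector_derivative
       - c * signed_power \<alpha> (signed_power p (v t)) - d * signed_power \<beta> (u t)) (at t within {0..})"
proof -
  define f where "f x = d * signed_power \<beta> x" for x
  define g where "g = signed_power p"
  define F where "F z = (g (snd z), - c * signed_power \<alpha> (g (snd z)) - f (fst z))" for z
  have contf: "continuous_on UNIV f"
    unfolding f_def using assms by (intro continuous_intros continuous_on_signed_power) auto
  have contg: "continuous_on UNIV g"
    unfolding g_def using assms by (intro continuous_on_signed_power) auto
  \<comment> \<open>This supplies the slope constants of \<open>coercive_antiderivative\<close>:
    \<open>d\<close> for \<open>f\<close> and \<open>1\<close> for \<open>g\<close>.\<close>
  have large: "\<bar>signed_power q x\<bar> \<ge> 1" if "\<bar>x\<bar> \<ge> 1" "q > -1" for q x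
    using that by (simp add: abs_signed_power ge_one_powr_ge_zero)
  obtain A where A: "\<And>x. (A has_real_derivative f x) (at x)" "\<And>x. A x \<ge> d * (\<bar>x\<bar> - 1)"
    using coercive_antiderivative[OF contf, of d] large[of _ \<beta>] signed_power_mult_self_nonneg[of \<beta>] assms
    by (auto simp: f_def abs_mult mult.assoc)
  obtain B where B: "\<And>x. (B has_real_derivative g x) (at x)" "\<And>x. B x \<ge> 1 * (\<bar>x\<bar> - 1)"
    using coercive_antiderivative[OF contg, of 1] large[of _ p] signed_power_mult_self_nonneg[of p] assms
    by (auto simp: g_def)
  define E where "E z = A (fst z) + B (snd z)" for z :: "real \<times> real"
  define E' where "E' z h = f (fst z) * fst h + g (snd z) * snd h" for z h :: "real \<times> real"
  have contF: "continuous_on UNIV F"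
    unfolding F_def
    using assms
    by (intro continuous_intros continuous_on_compose2[OF contg] continuous_on_compose2[OF contf]
        continuous_on_compose2[OF continuous_on_signed_power[of \<alpha> UNIV]]) auto
  have derE: "(E has_derivative E' z) (at z)" for z
  proof -
    have "((\<lambda>z. A (fst z)) has_derivative (\<lambda>h. f (fst z) * fst h)) (at z)"
      by (rule has_derivative_compose[OF has_derivative_fst[OF has_derivative_ident] A(1)[unfolded has_field_derivative_def]])
    moreover have "((\<lambda>z. B (snd z)) has_derivative (\<lambda>h. g (snd z) * snd h)) (at z)"
      by (rule has_derivative_compose[OF has_derivative_snd[OF has_derivative_ident] B(1)[unfolded has_field_derivative_def]])
    ultimately show ?thesis
      unfolding E_def[abs_def] E'_def[abs_def] by (rule has_derivative_add)
  qed
  have decr: "E' z (F z) \<le> 0" for z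
  proof -
    have "E' z (F z) = - (c * (signed_power \<alpha> (g (snd z)) * g (snd z)))"
      by (simp add: E'_def F_def algebra_simps)
    then show ?thesis
      using assms signed_power_mult_self_nonneg[of \<alpha>] by simp
  qed
  have bdE: "bounded {z. E z \<le> e}" for e
  proof -
    \<comment> \<open>Adding the lower bounds of \<open>A\<close> and \<open>B\<close> gives
      \<open>d * \<bar>fst z\<bar> + \<bar>snd z\<bar> \<le> e + d + 1\<close>.\<close>
    define R where "R = \<bar>e\<bar> + d + 1"
    have "\<bar>fst z\<bar> \<le> R / d \<and> \<bar>snd z\<bar> \<le> R" if "E z \<le> e" for z
    proof -
      have "d * \<bar>fst z\<bar> + \<bar>snd z\<bar> \<le> R"
        using A(2)[of "fst z"] B(2)[of "snd z"] that by (simp add: E_def R_def algebra_simps)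
      moreover have "d * \<bar>fst z\<bar> \<ge> 0" using assms by simp
      ultimately have "d * \<bar>fst z\<bar> \<le> R" "\<bar>snd z\<bar> \<le> R" by linarith+
      then show ?thesis using assms by (simp add: field_simps)
    qed
    then have "{z. E z \<le> e} \<subseteq> cbox (- (R / d), - R) (R / d, R)"
      by (force simp: cbox_Pair_eq abs_le_iff minus_le_iff)
    then show ?thesis using bounded_cbox bounded_subset by blast
  qed
  obtain x where x0: "x 0 = (u0, v0)"
    and x: "\<And>t. t \<ge> 0 \<Longrightarrow> (x has_vector_derivative F (x t)) (at t within {0..})"
    using ode_global_existence_Lyapunov[OF contF derE decr bdE] by metis
  show thesis
  proof (rule that[of "\<lambda>t. fst (x t)" "\<lambda>t. snd (x t)"])
    fix t :: real assume "t \<ge> 0"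
    note * = bounded_linear.has_vector_derivative[OF _ x[OF this]]
    show "((\<lambda>t. fst (x t)) has_vector_derivative signed_power p (snd (x t))) (at t within {0..})"
      using *[OF bounded_linear_fst] by (simp add: F_def g_def)
    show "((\<lambda>t. snd (x t)) has_vector_derivative
       - c * signed_power \<alpha> (signed_power p (snd (x t))) - d * signed_power \<beta> (fst (x t))) (at t within {0..})"
      using *[OF bounded_linear_snd] by (simp add: F_def g_def f_def)
  qed (simp_all add: x0)
qed

section \<open>Return to the second-order equation\<close>

text \<open>Every point of the half-line, its endpoint included, is a limit point from the right, so
  the derivative within it is unique.\<close>

lemma deriv_within_atLeast:
  assumes "(f has_vector_derivative f') (at t within {a..})" "t \<ge> a"
  shows "deriv_within {a..} f t = f'"
proof (rule vector_derivative_within[OF _ assms(1)])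
  have "t islimpt {t<..<t+1}" by (simp add: islimpt_greaterThanLessThan1)
  then have "t islimpt {a..}" by (rule islimpt_subset) (use assms(2) in auto)
  then show "at t within {a..} \<noteq> bot" by (simp add: trivial_limit_within)
qed

lemma C1_on_atLeastI:
  assumes der: "\<And>t. t \<ge> a \<Longrightarrow> (f has_vector_derivative f' t) (at t within {a..})"
    and cont: "continuous_on {a..} f'"
  shows "C1_on {a..} f"
  unfolding C1_on_def
proof
  show "f differentiable_on {a..}"
    unfolding differentiable_on_def
    using der by (auto simp: has_vector_derivative_def differentiable_def)
  show "continuous_on {a..} (deriv_within {a..} f)"
    using cont by (rule continuous_on_cong[THEN iffD1, rotated 2]) (auto simp: deriv_within_atLeast[OF der])
qed

theorem proposition2p1:
  fixes \<alpha> \<beta> c d l u0 u1 :: real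
  assumes "\<alpha> > 0" and "\<beta> > 0" and "c > 0" and "d > 0" and "l \<ge> 0"
  shows "\<exists>u :: real \<Rightarrow> real.
           is_solution l \<alpha> \<beta> c d {0..} u \<and>
           C1_on {0..} u \<and>
           C1_on {0..} (\<lambda>t. signed_power l (deriv_within {0..} u t)) \<and>
           u 0 = u0 \<and>
           deriv_within {0..} u 0 = u1"
proof -
  \<comment> \<open>With this exponent \<open>signed_power p\<close> is the two-sided inverse of
    \<open>signed_power l\<close>; \<open>p \<le> 0\<close> because
    \<open>l \<ge> 0\<close>.\<close>
  define p where "p = 1 / (l + 1) - 1"
  have p: "p > -1" "(l + 1) * (p + 1) = 1" "(p + 1) * (l + 1) = 1"
    using assms by (auto simp: p_def field_simps)
  \<comment> \<open>The initial value of \<open>v\<close> is chosen so that applying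
    \<open>signed_power p\<close> to it returns the prescribed velocity \<open>u1\<close>.\<close>
  obtain u v where init: "u 0 = u0" "v 0 = signed_power l u1"
    and u: "\<And>t. t \<ge> 0 \<Longrightarrow> (u has_vector_derivative signed_power p (v t)) (at t within {0..})"
    and v: "\<And>t. t \<ge> 0 \<Longrightarrow> (v has_vector_derivative
       - c * signed_power \<alpha> (signed_power p (v t)) - d * signed_power \<beta> (u t)) (at t within {0..})"
    using damped_system_global_existence[of \<alpha> \<beta> c d p u0 "signed_power l u1"] assms p(1) by auto
  note du = deriv_within_atLeast[OF u]
  define w where "w = (\<lambda>t. signed_power l (deriv_within {0..} u t))"
  \<comment> \<open>Agreement on \<open>{0..}\<close> suffices to carry derivatives within
    \<open>{0..}\<close> over from \<open>v\<close> to \<open>w\<close>, the function occurring in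
    \<open>is_solution\<close>.\<close>
  have w: "w t = v t" if "t \<ge> 0" for t
    using that p by (simp add: w_def du signed_power_signed_power)
  have der_w: "(w has_vector_derivative
       - c * signed_power \<alpha> (signed_power p (v t)) - d * signed_power \<beta> (u t)) (at t within {0..})"
    if "t \<ge> 0" for t
    using that w v by (intro has_vector_derivative_transform[of t _ w v]) auto
  have contu: "continuous_on {0..} u" and contv: "continuous_on {0..} v"
    using u v by (auto simp: continuous_on_eq_continuous_within intro: has_vector_derivative_continuous)
  have contg: "continuous_on {0..} (\<lambda>t. signed_power p (v t))"
    by (rule continuous_on_compose2[OF continuous_on_signed_power[OF p(1), of UNIV] contv]) auto
  have C1u: "C1_on {0..} u"
    using u contg by (rule C1_on_atLeastI)
  have "continuous_on {0..} (\<lambda>t. - c * signed_power \<alpha> (signed_power p (v t)) - d * signed_power \<beta> (u t))"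
    using assms
    by (intro continuous_intros continuous_on_compose2[OF continuous_on_signed_power[of \<alpha> UNIV] contg]
        continuous_on_compose2[OF continuous_on_signed_power[of \<beta> UNIV] contu]) auto
  with der_w have C1w: "C1_on {0..} w"
    by (rule C1_on_atLeastI)
  have "is_solution l \<alpha> \<beta> c d {0..} u"
    using C1u C1w unfolding is_solution_def w_def[symmetric]
    by (auto simp: du deriv_within_atLeast[OF der_w])
  moreover have "deriv_within {0..} u 0 = u1"
    using p by (simp add: du init signed_power_signed_power)
  ultimately show ?thesis
    using C1u C1w init unfolding w_def by blast
qed

end
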